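(* Let $\alpha\geq\aleph_{0}$ and $\beta\ge\alpha$ be cardinal numbers. For every real $p>0$, the set $L_{p}[0,1]\setminus\bigcup_{q\in(p,\infty)}L_{q}[0,1]$ is not $(\alpha,\beta)$-spaceable in $L_p[0,1]$.
   Context: $\mathbb{K}$ denotes $\mathbb{R}$ or $\mathbb{C}$; $L_p[0,1]$ is the usual Lebesgue space of (classes of) $\mathbb{K}$-valued functions on $[0,1]$ with its usual norm ($p\ge1$) or $p$-norm ($0<p<1$) topology. Dimension means algebraic (Hamel) dimension. A subset $A$ of a vector space $V$ is $\alpha$-lineable if $A\cup\{0\}$ contains an $\alpha$-dimensional vector subspace of $V$. For cardinals $\alpha\le\beta$ and $V$ endowed with a topology, a non-void subset $A\subset V$ is $(\alpha,\beta)$-spaceable if it is $\alpha$-lineable and for each $\alpha$-dimensional subspace $W_\alpha\subset A\cup\{0\}$ there is a closed $\beta$-dimensional subspace $W_\beta$ of $V$ with $W_\alpha\subset W_\beta\subset A\cup\{0\}$. *)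

theory Defs
  imports "HOL-Analysis.Analysis"
begin

unbundle cardinal_syntax

section \<open>Lineability and spaceability\<close>

text \<open>
  Cardinal numbers are represented by cardinal orders, as usual in the library.
  The vector space \<open>V\<close> under consideration may be a proper subspace of the ambient type:
  it is the topological space of the topology \<open>T\<close>, so \<open>closedin T W\<close> includes \<open>W \<subseteq> V\<close>.
  The inclusion \<open>A \<subseteq> V\<close> is understood and not part of the predicates below. A subspace has
  dimension \<open>\<alpha>\<close> if it has a Hamel basis of that cardinality (all its Hamel bases are equinumerous).
\<close>

context vector_space
begin

definition has_dim :: "'b set \<Rightarrow> 'c rel \<Rightarrow> bool" where
  "has_dim W \<alpha> \<longleftrightarrow> (\<exists>B. independent B \<and> span B = W \<and> |B| =o \<alpha>)"

definition lineable :: "'c rel \<Rightarrow> 'b set \<Rightarrow> bool" where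
  "lineable \<alpha> A \<longleftrightarrow> (\<exists>W. subspace W \<and> local.has_dim W \<alpha> \<and> W \<subseteq> A \<union> {0})"

definition spaceable :: "'c rel \<Rightarrow> 'd rel \<Rightarrow> 'b topology \<Rightarrow> 'b set \<Rightarrow> bool" where
  "spaceable \<alpha> \<beta> T A \<longleftrightarrow>
     A \<noteq> {} \<and> local.lineable \<alpha> A \<and>
     (\<forall>W\<^sub>\<alpha>. subspace W\<^sub>\<alpha> \<and> local.has_dim W\<^sub>\<alpha> \<alpha> \<and> W\<^sub>\<alpha> \<subseteq> A \<union> {0} \<longrightarrow>
       (\<exists>W\<^sub>\<beta>. subspace W\<^sub>\<beta> \<and> closedin T W\<^sub>\<beta> \<and> local.has_dim W\<^sub>\<beta> \<beta> \<and> W\<^sub>\<alpha> \<subseteq> W\<^sub>\<beta> \<and> W\<^sub>\<beta> \<subseteq> A \<union> {0}))"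

end


section \<open>Classes of measurable functions on the unit interval\<close>

abbreviation unit_leb :: "real measure" where
  "unit_leb \<equiv> lebesgue_on {0..1}"

definition ae_eq :: "(real \<Rightarrow> 'k::{real_normed_field, second_countable_topology}) \<Rightarrow> (real \<Rightarrow> 'k) \<Rightarrow> bool" where
  "ae_eq f g \<longleftrightarrow> f \<in> borel_measurable unit_leb \<and> g \<in> borel_measurable unit_leb \<and>
     (AE x in unit_leb. f x = g x)"

quotient_type (overloaded) 'k L0 =
  "real \<Rightarrow> 'k::{real_normed_field, second_countable_topology}" / partial: ae_eq
proof (rule part_equivpI)
  show "\<exists>f::real \<Rightarrow> 'k. ae_eq f f"
    by (rule exI[of _ "\<lambda>_. 0"]) (simp add: ae_eq_def)
  show "symp (ae_eq :: (real \<Rightarrow> 'k) \<Rightarrow> _)"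
    by (auto intro!: sympI simp: ae_eq_def eq_commute)
  show "transp (ae_eq :: (real \<Rightarrow> 'k) \<Rightarrow> _)"
  proof (rule transpI)
    fix f g h :: "real \<Rightarrow> 'k"
    assume "ae_eq f g" "ae_eq g h"
    then have "AE x in unit_leb. f x = g x" "AE x in unit_leb. g x = h x"
      by (auto simp: ae_eq_def)
    then have "AE x in unit_leb. f x = h x"
      by eventually_elim simp
    with \<open>ae_eq f g\<close> \<open>ae_eq g h\<close> show "ae_eq f h"
      by (auto simp: ae_eq_def)
  qed
qed

instantiation L0 :: ("{real_normed_field, second_countable_topology}") ab_group_add
begin

lift_definition zero_L0 :: "'a L0" is "\<lambda>_. 0"
  by (simp add: ae_eq_def)

lift_definition plus_L0 :: "'a L0 \<Rightarrow> 'a L0 \<Rightarrow> 'a L0" is "\<lambda>f g x. f x + g x"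
  by (auto simp: ae_eq_def)

lift_definition uminus_L0 :: "'a L0 \<Rightarrow> 'a L0" is "\<lambda>f x. - f x"
  by (auto simp: ae_eq_def)

lift_definition minus_L0 :: "'a L0 \<Rightarrow> 'a L0 \<Rightarrow> 'a L0" is "\<lambda>f g x. f x - g x"
  by (auto simp: ae_eq_def)

instance
  by standard (transfer; auto simp: ae_eq_def algebra_simps)+

end

lift_definition scale_L0 ::
  "'k::{real_normed_field, second_countable_topology} \<Rightarrow> 'k L0 \<Rightarrow> 'k L0" is "\<lambda>c f x. c * f x"
  by (auto simp: ae_eq_def)

global_interpretation L0: vector_space
  "scale_L0 :: 'k::{real_normed_field, second_countable_topology} \<Rightarrow> 'k L0 \<Rightarrow> 'k L0"
  by standard (transfer; auto simp: ae_eq_def algebra_simps)+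


section \<open>The spaces \<open>L\<^sub>p[0,1]\<close>\<close>

lemma ae_eq_norm_powr:
  assumes "ae_eq f g"
  shows "(\<lambda>x. norm (f x) powr p) \<in> borel_measurable unit_leb"
    and "(\<lambda>x. norm (g x) powr p) \<in> borel_measurable unit_leb"
    and "AE x in unit_leb. norm (f x) powr p = norm (g x) powr p"
  using assms by (auto simp: ae_eq_def)

lift_definition in_Lp :: "real \<Rightarrow> 'k::{real_normed_field, second_countable_topology} L0 \<Rightarrow> bool" is
  "\<lambda>p f. integrable unit_leb (\<lambda>x. norm (f x) powr p)"
  by (intro integrable_cong_AE ae_eq_norm_powr)

definition Lp :: "real \<Rightarrow> 'k::{real_normed_field, second_countable_topology} L0 set" where
  "Lp p = {f. in_Lp p f}"

lift_definition Lp_integral :: "real \<Rightarrow> 'k::{real_normed_field, second_countable_topology} L0 \<Rightarrow> real" is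
  "\<lambda>p f. LINT x|unit_leb. norm (f x) powr p"
  by (intro integral_cong_AE ae_eq_norm_powr)

text \<open>
  For \<open>0 < p < 1\<close> the \<open>p\<close>-norm is the integral itself (no \<open>p\<close>-th root), which is subadditive but
  not homogeneous. The values are meaningful only on \<open>Lp p\<close> for \<open>p > 0\<close>.
\<close>

definition Lp_norm :: "real \<Rightarrow> 'k::{real_normed_field, second_countable_topology} L0 \<Rightarrow> real" where
  "Lp_norm p f = (if p \<ge> 1 then Lp_integral p f powr (1 / p) else Lp_integral p f)"

definition Lp_dist :: "real \<Rightarrow> 'k::{real_normed_field, second_countable_topology} L0 \<Rightarrow> 'k L0 \<Rightarrow> real" where
  "Lp_dist p f g = Lp_norm p (f - g)"

definition Lp_topology :: "real \<Rightarrow> 'k::{real_normed_field, second_countable_topology} L0 topology" where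
  "Lp_topology p = Metric_space.mtopology (Lp p) (Lp_dist p)"


lemma powr_add_le_add_powr:
  fixes a b p :: real
  assumes "0 \<le> a" "0 \<le> b" "0 < p" "p \<le> 1"
  shows "(a + b) powr p \<le> a powr p + b powr p"
proof (cases "a + b = 0")
  case False
  define s where "s = a + b"
  have s: "s > 0" using False assms by (simp add: s_def)
  have le: "c / s \<le> (c / s) powr p" if "0 \<le> c" "c \<le> s" for c
  proof (cases "c = 0")
    case False
    with that s have "0 < c / s" "c / s \<le> 1" by auto
    then have "(c / s) powr 1 \<le> (c / s) powr p"
      using assms by (intro powr_mono') auto
    moreover have "(c / s) powr 1 = c / s" using \<open>0 < c / s\<close> by (intro powr_one) simp
    ultimately show ?thesis by (simp only:)
  qed auto
  have "1 = a / s + b / s" using s by (simp add: s_def add_divide_distrib[symmetric])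
  also have "\<dots> \<le> (a / s) powr p + (b / s) powr p"
    using assms by (intro add_mono le) (auto simp: s_def)
  also have "\<dots> = (a powr p + b powr p) / s powr p"
    using assms s by (simp add: powr_divide add_divide_distrib)
  finally show ?thesis using s by (simp add: s_def field_simps)
qed (use assms in auto)

lemma powr_convex_nonneg:
  fixes p s t x y :: real
  assumes "p \<ge> 1" "0 < s" "0 < t" "s + t = 1" "0 \<le> x" "0 \<le> y"
  shows "(s * x + t * y) powr p \<le> s * x powr p + t * y powr p"
proof -
  have le: "c powr p \<le> c" if "0 < c" "c \<le> 1" for c :: real
    using powr_mono'[of 1 p c] that assms by simp
  consider "x = 0" | "y = 0" | "x > 0" "y > 0" using assms by fastforce
  then show ?thesis
  proof cases
    case 1
    then show ?thesis using assms le[of t] by (auto simp: powr_mult intro!: mult_right_mono)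
  next
    case 2
    then show ?thesis using assms le[of s] by (auto simp: powr_mult intro!: mult_right_mono)
  next
    case 3
    have "s = 1 - t" using assms by simp
    with 3 show ?thesis
      using convex_onD[OF powr_convex[OF assms(1)], of t x y] assms(2,3) by simp
  qed
qed

lemma powr_add_le_weighted:
  fixes a b u v p :: real
  assumes "p \<ge> 1" "0 < a" "0 < b" "0 \<le> u" "0 \<le> v"
  shows "(u + v) powr p \<le>
    (a + b) powr p * (a / (a + b) / a powr p * u powr p + b / (a + b) / b powr p * v powr p)"
proof -
  have "(a + b) * (a / (a + b) * (u / a)) = u" "(a + b) * (b / (a + b) * (v / b)) = v"
    using assms by auto
  then have "u + v = (a + b) * (a / (a + b) * (u / a) + b / (a + b) * (v / b))"
    by (simp only: distrib_left)
  then have "(u + v) powr p =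
      (a + b) powr p * (a / (a + b) * (u / a) + b / (a + b) * (v / b)) powr p"
    using assms by (metis powr_mult)
  also have "(a / (a + b) * (u / a) + b / (a + b) * (v / b)) powr p
      \<le> a / (a + b) * (u / a) powr p + b / (a + b) * (v / b) powr p"
    using assms by (intro powr_convex_nonneg) (auto simp: add_divide_distrib[symmetric])
  also have "\<dots> = a / (a + b) / a powr p * u powr p + b / (a + b) / b powr p * v powr p"
    using assms by (simp add: powr_divide)
  finally show ?thesis using assms by (simp add: mult_left_mono)
qed

lemma norm_add_powr_le:
  fixes x y :: "'k::real_normed_field"
  assumes "p > 0"
  shows "norm (x + y) powr p \<le> 2 powr p * (norm x powr p + norm y powr p)"
proof -
  have "norm (x + y) powr p \<le> (2 * max (norm x) (norm y)) powr p"
    using assms norm_triangle_ineq[of x y] by (intro powr_mono2) auto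
  also have "\<dots> = 2 powr p * max (norm x) (norm y) powr p"
    by (simp add: powr_mult)
  also have "\<dots> \<le> 2 powr p * (norm x powr p + norm y powr p)"
    by (intro mult_left_mono) (auto simp: max_def)
  finally show ?thesis .
qed

lemma in_Lp_add:
  fixes f g :: "'k::{real_normed_field, second_countable_topology} L0"
  assumes "p > 0" "in_Lp p f" "in_Lp p g"
  shows "in_Lp p (f + g)"
  using assms
proof (transfer fixing: p)
  fix f g :: "real \<Rightarrow> 'k"
  assume "ae_eq f f" "ae_eq g g" and p: "p > 0"
    and int: "integrable unit_leb (\<lambda>x. norm (f x) powr p)"
      "integrable unit_leb (\<lambda>x. norm (g x) powr p)"
  then have [measurable]: "f \<in> borel_measurable unit_leb" "g \<in> borel_measurable unit_leb"
    by (auto simp: ae_eq_def)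
  show "integrable unit_leb (\<lambda>x. norm (f x + g x) powr p)"
  proof (rule Bochner_Integration.integrable_bound)
    show "integrable unit_leb (\<lambda>x. 2 powr p * (norm (f x) powr p + norm (g x) powr p))"
      using int by auto
    show "AE x in unit_leb. norm (norm (f x + g x) powr p)
        \<le> norm (2 powr p * (norm (f x) powr p + norm (g x) powr p))"
      using norm_add_powr_le[OF p] by (auto intro!: AE_I2 simp: abs_mult)
  qed measurable
qed

lemma in_Lp_scale: "in_Lp p f \<Longrightarrow> in_Lp p (scale_L0 c f)"
  by transfer (auto simp: norm_mult powr_mult)

lemma in_Lp_0: "in_Lp p 0"
  by transfer auto

lemma subspace_Lp: "p > 0 \<Longrightarrow> L0.subspace (Lp p)"
  by (auto simp: L0.subspace_def Lp_def in_Lp_add in_Lp_scale in_Lp_0)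

lemma in_Lp_diff: "p > 0 \<Longrightarrow> in_Lp p f \<Longrightarrow> in_Lp p g \<Longrightarrow> in_Lp p (f - g)"
  using L0.subspace_diff[OF subspace_Lp, of p f g] by (simp add: Lp_def)

lemma Lp_integral_nonneg: "Lp_integral p f \<ge> 0"
  by transfer auto

lemma Lp_integral_commute: "Lp_integral p (f - g) = Lp_integral p (g - f)"
  by transfer (simp add: norm_minus_commute)

lemma Lp_integral_0: "Lp_integral p 0 = 0"
  by transfer simp

lemma Lp_integral_eq_0_iff: "in_Lp p f \<Longrightarrow> Lp_integral p f = 0 \<longleftrightarrow> f = 0"
  by transfer (simp add: integral_nonneg_eq_0_iff_AE ae_eq_def)

lemma Lp_integral_add_le:
  fixes f g :: "'k::{real_normed_field, second_countable_topology} L0"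
  assumes "p > 0" "p \<le> 1" "in_Lp p f" "in_Lp p g"
  shows "Lp_integral p (f + g) \<le> Lp_integral p f + Lp_integral p g"
  using assms in_Lp_add[OF assms(1,3,4)]
proof (transfer fixing: p)
  fix f g :: "real \<Rightarrow> 'k"
  assume p: "p > 0" "p \<le> 1"
    and int: "integrable unit_leb (\<lambda>x. norm (f x) powr p)"
      "integrable unit_leb (\<lambda>x. norm (g x) powr p)"
      "integrable unit_leb (\<lambda>x. norm (f x + g x) powr p)"
  have le: "norm (f x + g x) powr p \<le> norm (f x) powr p + norm (g x) powr p" for x
    using powr_mono2[OF _ _ norm_triangle_ineq[of "f x" "g x"], of p]
      powr_add_le_add_powr[of "norm (f x)" "norm (g x)" p] p by simp
  have "(LINT x|unit_leb. norm (f x + g x) powr p)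
      \<le> (LINT x|unit_leb. norm (f x) powr p + norm (g x) powr p)"
    using int le by (intro integral_mono) auto
  then show "(LINT x|unit_leb. norm (f x + g x) powr p)
      \<le> (LINT x|unit_leb. norm (f x) powr p) + (LINT x|unit_leb. norm (g x) powr p)"
    using int by simp
qed

lemma Lp_integral_add_le_weighted:
  fixes f g :: "'k::{real_normed_field, second_countable_topology} L0"
  assumes "p \<ge> 1" "a > 0" "b > 0" "in_Lp p f" "in_Lp p g"
  shows "Lp_integral p (f + g) \<le> (a + b) powr p *
    (a / (a + b) / a powr p * Lp_integral p f + b / (a + b) / b powr p * Lp_integral p g)"
proof -
  have "in_Lp p (f + g)" using assms by (intro in_Lp_add) auto
  with assms show ?thesis
  proof (transfer fixing: p a b)
    fix f g :: "real \<Rightarrow> 'k"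
    assume p: "p \<ge> 1" and ab: "a > 0" "b > 0"
      and int: "integrable unit_leb (\<lambda>x. norm (f x) powr p)"
        "integrable unit_leb (\<lambda>x. norm (g x) powr p)"
        "integrable unit_leb (\<lambda>x. norm (f x + g x) powr p)"
    define A where "A = a / (a + b) / a powr p"
    define B where "B = b / (a + b) / b powr p"
    have le: "norm (f x + g x) powr p
        \<le> (a + b) powr p * (A * norm (f x) powr p + B * norm (g x) powr p)" for x
      unfolding A_def B_def
      using powr_mono2[OF _ _ norm_triangle_ineq[of "f x" "g x"], of p]
        powr_add_le_weighted[OF p ab, of "norm (f x)" "norm (g x)"] p by simp
    have "(LINT x|unit_leb. norm (f x + g x) powr p)
        \<le> (LINT x|unit_leb. (a + b) powr p * (A * norm (f x) powr p + B * norm (g x) powr p))"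
      using int le by (intro integral_mono) auto
    also have "\<dots> = (a + b) powr p * (A * (LINT x|unit_leb. norm (f x) powr p)
        + B * (LINT x|unit_leb. norm (g x) powr p))"
      using int by simp
    finally show "(LINT x|unit_leb. norm (f x + g x) powr p)
      \<le> (a + b) powr p * (a / (a + b) / a powr p * (LINT x|unit_leb. norm (f x) powr p)
        + b / (a + b) / b powr p * (LINT x|unit_leb. norm (g x) powr p))"
      unfolding A_def B_def .
  qed
qed

lemma Lp_norm_triangle:
  assumes "p > 0" "in_Lp p f" "in_Lp p g"
  shows "Lp_norm p (f + g) \<le> Lp_norm p f + Lp_norm p g"
proof (cases "p \<ge> 1")
  case False
  then show ?thesis using Lp_integral_add_le[of p f g] assms by (simp add: Lp_norm_def)
next
  case True
  define a where "a = Lp_norm p f"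
  define b where "b = Lp_norm p g"
  consider "f = 0" | "g = 0" | "f \<noteq> 0" "g \<noteq> 0" by blast
  then show ?thesis
  proof cases
    case 3
    have pos: "Lp_integral p f > 0" "Lp_integral p g > 0"
      using 3 assms Lp_integral_nonneg[of p f] Lp_integral_nonneg[of p g]
      by (auto simp: less_le Lp_integral_eq_0_iff dest: sym)
    then have ab: "a > 0" "b > 0" by (auto simp: a_def b_def Lp_norm_def)
    have eq: "a powr p = Lp_integral p f" "b powr p = Lp_integral p g"
      using True pos by (auto simp: a_def b_def Lp_norm_def powr_powr)
    have "Lp_integral p (f + g) \<le> (a + b) powr p *
        (a / (a + b) / a powr p * a powr p + b / (a + b) / b powr p * b powr p)"
      using Lp_integral_add_le_weighted[OF True ab assms(2,3)] by (simp only: eq)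
    also have "a / (a + b) / a powr p * a powr p + b / (a + b) / b powr p * b powr p = 1"
      using ab by (simp add: add_divide_distrib[symmetric])
    finally have "Lp_integral p (f + g) powr (1 / p) \<le> ((a + b) powr p) powr (1 / p)"
      using True by (intro powr_mono2) (auto simp: Lp_integral_nonneg)
    then show ?thesis using True ab by (simp add: powr_powr Lp_norm_def a_def b_def)
  qed (auto simp: Lp_norm_def Lp_integral_0)
qed

lemma Metric_space_Lp:
  fixes p :: real
  assumes "p > 0"
  shows "Metric_space (Lp p :: 'k::{real_normed_field, second_countable_topology} L0 set) (Lp_dist p)"
proof
  fix f g h :: "'k L0"
  show "0 \<le> Lp_dist p f g"
    by (simp add: Lp_dist_def Lp_norm_def Lp_integral_nonneg)
  show "Lp_dist p f g = Lp_dist p g f"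
    by (simp add: Lp_dist_def Lp_norm_def Lp_integral_commute)
  assume f: "f \<in> Lp p" and g: "g \<in> Lp p"
  then have "in_Lp p (f - g)" using assms by (simp add: Lp_def in_Lp_diff)
  then show "Lp_dist p f g = 0 \<longleftrightarrow> f = g"
    by (auto simp: Lp_dist_def Lp_norm_def Lp_integral_eq_0_iff)
  assume "h \<in> Lp p"
  with f g show "Lp_dist p f h \<le> Lp_dist p f g + Lp_dist p g h"
    using Lp_norm_triangle[OF assms, of "f - g" "g - h"] assms
    by (simp add: Lp_def in_Lp_diff Lp_dist_def)
qed

end

theory Submission
  imports Defs
begin

text \<open>
  Write \<open>A\<close> for the functions that lie in \<open>L\<^sub>p\<close> and in no \<open>L\<^sub>q\<close> with \<open>q > p\<close>. The constant function
  \<open>1\<close> lies in every \<open>L\<^sub>q\<close>, so \<open>A\<close> is invariant under adding constants, while no nonzero constant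
  belongs to \<open>A\<close>. Spaceability fails because an infinite-dimensional subspace inside \<open>A \<union> {0}\<close> can
  be tilted, without leaving \<open>A \<union> {0}\<close> and without changing its dimension, until \<open>1\<close> is in its
  closure.

  Let \<open>W \<subseteq> A \<union> {0}\<close> have a Hamel basis \<open>B\<close>, choose distinct \<open>b\<^sub>0, b\<^sub>1, \<dots>\<close> in \<open>B\<close>, and choose
  \<open>\<epsilon>\<^sub>n \<noteq> 0\<close> so small that \<open>\<epsilon>\<^sub>n b\<^sub>n \<rightarrow> 0\<close> in \<open>L\<^sub>p\<close>. Replacing each \<open>b\<^sub>n\<close> by \<open>b\<^sub>n + \<epsilon>\<^sub>n\<^sup>-\<^sup>1\<close> and
  shifting the other basis vectors by arbitrary constants moves every vector of \<open>W\<close> by a constant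
  only. The nonzero vectors therefore stay in \<open>A\<close>; in particular
  none is sent to \<open>0\<close>, so the dimension is preserved (\<open>has_dim_tilt\<close>). The tilted space
  contains \<open>\<epsilon>\<^sub>n b\<^sub>n + 1\<close>, which tends to \<open>1\<close>. A closed subspace above it contains \<open>1\<close> and so is not
  contained in \<open>A \<union> {0}\<close>.
\<close>

text \<open>
  The tilted space is the image of \<open>span B\<close> under \<open>w \<mapsto> w + \<psi> w\<close>, where \<open>\<psi>\<close> is the linear map
  with \<open>b \<mapsto> c b \<cdot> u\<close> on \<open>B\<close>. As \<open>\<psi>\<close> takes values in the line through \<open>u\<close>, the invariance of \<open>A\<close>
  keeps nonzero vectors in \<open>A\<close>, which yields both the inclusion and the injectivity.
\<close>

lemma (in vector_space) has_dim_tilt: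
  fixes \<alpha> :: "'c rel"
  assumes B: "independent B" "|B| =o \<alpha>" "span B \<subseteq> A \<union> {0}"
    and A: "0 \<notin> A" "\<And>a k. a \<in> A \<Longrightarrow> a + scale k u \<in> A"
  obtains W where "subspace W" "has_dim W \<alpha>" "W \<subseteq> A \<union> {0}" "\<And>b. b \<in> B \<Longrightarrow> b + scale (c b) u \<in> W"
proof -
  interpret vector_space_pair scale scale ..
  obtain \<psi> where \<psi>: "Vector_Spaces.linear scale scale \<psi>" "\<And>b. b \<in> B \<Longrightarrow> \<psi> b = scale (c b) u"
      "range \<psi> = span ((\<lambda>b. scale (c b) u) ` B)"
    using linear_independent_extend_subspace[OF B(1), of "\<lambda>b. scale (c b) u"] by blast
  have line: "\<exists>k. \<psi> w = scale k u" for w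
  proof -
    have "(\<lambda>b. scale (c b) u) ` B \<subseteq> span {u}"
      by (auto intro: span_scale span_base)
    then have "\<psi> w \<in> span {u}"
      using \<psi>(3) span_minimal[OF _ subspace_span] by blast
    then show ?thesis by (auto simp: span_singleton)
  qed
  define T where "T = (\<lambda>w. w + \<psi> w)"
  have lin: "Vector_Spaces.linear scale scale T"
    unfolding T_def by (intro linear_compose_add linear_ident \<psi>(1))
  have T_in: "T w \<in> A" if "w \<in> span B" "w \<noteq> 0" for w
  proof -
    obtain k where "\<psi> w = scale k u" using line by blast
    then show ?thesis using that B(3) A(2)[of w k] by (auto simp: T_def)
  qed
  have inj: "inj_on T (span B)"
  proof -
    interpret T: Vector_Spaces.linear scale scale T by (rule lin)
    show ?thesis
      unfolding T.inj_on_iff_eq_0[OF subspace_span] using T_in A(1) by metis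
  qed
  have "span (T ` B) = T ` span B"
    by (rule linear_span_image[OF lin])
  moreover have "independent (T ` B)"
    by (rule linear_independent_injective_image[OF lin B(1) inj])
  moreover have "|T ` B| =o \<alpha>"
  proof -
    have "bij_betw T B (T ` B)"
      using inj inj_on_subset[OF _ span_superset] by (auto simp: bij_betw_def)
    then have "|B| =o |T ` B|" by (rule card_of_ordIsoI)
    then show ?thesis using B(2) ordIso_symmetric ordIso_transitive by blast
  qed
  ultimately have dim: "has_dim (T ` span B) \<alpha>"
    unfolding has_dim_def by blast
  show thesis
  proof (rule that)
    show "subspace (T ` span B)"
      by (rule linear_subspace_image[OF lin subspace_span])
    show "T ` span B \<subseteq> A \<union> {0}"
      using T_in linear_0[OF lin] by fastforce
    show "b + scale (c b) u \<in> T ` span B" if "b \<in> B" for b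
      using that \<psi>(2) span_base by (force simp: T_def)
  qed (rule dim)
qed

lift_definition one_L0 :: "'k::{real_normed_field, second_countable_topology} L0" is "\<lambda>_. 1"
  by (simp add: ae_eq_def)

lemma one_L0_in_Lp: "one_L0 \<in> Lp p"
proof -
  have "in_Lp p (one_L0 :: 'a L0)"
    by transfer (auto intro!: finite_measure.integrable_const finite_measureI
      simp: emeasure_restrict_space)
  then show ?thesis by (simp add: Lp_def)
qed

lemma one_L0_nonzero: "(one_L0 :: 'k::{real_normed_field, second_countable_topology} L0) \<noteq> 0"
proof (transfer, rule notI)
  assume "ae_eq (\<lambda>_. 1 :: 'k) (\<lambda>_. 0)"
  then have "AE x in unit_leb. False" by (simp add: ae_eq_def)
  then have "emeasure unit_leb (space unit_leb) = 0"
    using AE_iff_measurable[OF sets.top, of unit_leb "\<lambda>_. False"] by (auto simp: set_eq_iff)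
  then show False by (simp add: emeasure_restrict_space)
qed

lemma Lp_integral_scale: "Lp_integral p (scale_L0 c f) = norm c powr p * Lp_integral p f"
  by transfer (simp add: norm_mult powr_mult)

lemma Lp_norm_scale_tendsto_0:
  fixes f :: "'k::{real_normed_field, second_countable_topology} L0"
  assumes "p > 0"
  shows "(\<lambda>n. Lp_norm p (scale_L0 (of_real (inverse (real (Suc n)))) f)) \<longlonglongrightarrow> 0"
proof -
  have "(\<lambda>n. inverse (real (Suc n)) powr p * Lp_integral p f) \<longlonglongrightarrow> 0 powr p * Lp_integral p f"
    using assms LIMSEQ_inverse_real_of_nat
    by (intro tendsto_mult tendsto_powr' tendsto_const) auto
  then have I: "(\<lambda>n. Lp_integral p (scale_L0 (of_real (inverse (real (Suc n)))) f)) \<longlonglongrightarrow> 0"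
    unfolding Lp_integral_scale norm_of_real by simp
  show ?thesis
  proof (cases "p \<ge> 1")
    case True
    have "(\<lambda>n. Lp_integral p (scale_L0 (of_real (inverse (real (Suc n)))) f) powr (1 / p))
        \<longlonglongrightarrow> 0 powr (1 / p)"
      using True by (intro tendsto_powr'[OF I tendsto_const]) (simp add: Lp_integral_nonneg)
    then show ?thesis using True by (simp add: Lp_norm_def)
  qed (use I in \<open>simp add: Lp_norm_def\<close>)
qed

lemma exists_scale_Lp_norm_less:
  fixes f :: "'k::{real_normed_field, second_countable_topology} L0"
  assumes "p > 0" "r > 0"
  obtains c :: 'k where "c \<noteq> 0" "Lp_norm p (scale_L0 c f) < r"
proof -
  obtain n where "Lp_norm p (scale_L0 (of_real (inverse (real (Suc n)))) f) < r"
    using order_tendstoD(2)[OF Lp_norm_scale_tendsto_0[OF assms(1)] assms(2)]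
    by (auto simp: eventually_sequentially)
  then show thesis by (intro that[of "of_real (inverse (real (Suc n)))"]) (auto simp del: of_nat_Suc)
qed

text \<open>
  Infinite dimension provides a different basis vector \<open>b\<^sub>n\<close> for each \<open>n\<close>, so that all the shifts
  by \<open>\<epsilon>\<^sub>n\<^sup>-\<^sup>1\<close> can be made by one linear map even if these numbers are unbounded.
  Closedness is contradicted at the point \<open>1\<close> alone.
\<close>

theorem not_spaceable_Lp_minus_Union_Lq:
  fixes \<alpha> :: "'a rel" and \<beta> :: "'b rel" and p :: real
  assumes \<alpha>: "natLeq \<le>o \<alpha>" and p: "p > 0"
  shows "\<not> L0.spaceable \<alpha> \<beta> (Lp_topology p)
    ((Lp p :: 'k::{real_normed_field, second_countable_topology} L0 set) - (\<Union>q\<in>{p<..}. Lp q))"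
proof
  define A where "A = (Lp p :: 'k L0 set) - (\<Union>q\<in>{p<..}. Lp q)"
  assume "L0.spaceable \<alpha> \<beta> (Lp_topology p) (Lp p - (\<Union>q\<in>{p<..}. Lp q) :: 'k L0 set)"
  then have sp: "L0.spaceable \<alpha> \<beta> (Lp_topology p) A" by (simp only: A_def)
  have A0: "0 \<notin> A"
  proof -
    have "(0::'k L0) \<in> Lp (p + 1)" by (simp add: Lp_def in_Lp_0)
    then show ?thesis using p by (force simp: A_def)
  qed
  have A1: "one_L0 \<notin> A"
    using one_L0_in_Lp[of "p + 1"] by (force simp: A_def)
  have A_inv: "a + scale_L0 k one_L0 \<in> A" if a: "a \<in> A" for a k
  proof -
    have k: "scale_L0 k one_L0 \<in> Lp q" for q
      using one_L0_in_Lp[where 'a='k] by (simp add: Lp_def in_Lp_scale)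
    have "a \<in> Lp q" if "q > p" "a + scale_L0 k one_L0 \<in> Lp q" for q
      using L0.subspace_diff[OF subspace_Lp that(2) k] that(1) p by simp
    moreover have "a + scale_L0 k one_L0 \<in> Lp p"
      using a k p by (simp add: A_def L0.subspace_add subspace_Lp)
    ultimately show ?thesis using a by (auto simp: A_def)
  qed
  obtain B where B: "L0.independent B" "|B| =o \<alpha>" "L0.span B \<subseteq> A \<union> {0}"
  proof -
    have "L0.lineable \<alpha> A" using sp by (simp only: L0.spaceable_def)
    then obtain W where W: "L0.has_dim W \<alpha>" "W \<subseteq> A \<union> {0}"
      unfolding L0.lineable_def by blast
    obtain B where B: "L0.independent B" "L0.span B = W" "|B| =o \<alpha>"
      using W(1) unfolding L0.has_dim_def by blast
    show thesis
      by (rule that[OF B(1,3)]) (use B(2) W(2) in \<open>simp only:\<close>)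
  qed
  have "natLeq \<le>o |B|"
    using \<alpha> B(2) ordIso_symmetric ordLeq_ordIso_trans by blast
  then have "infinite B" using infinite_iff_natLeq_ordLeq by blast
  then obtain b :: "nat \<Rightarrow> 'k L0" where b: "inj b" "range b \<subseteq> B"
    using infinite_countable_subset by blast
  have "\<exists>c::'k. c \<noteq> 0 \<and> Lp_norm p (scale_L0 c (b n)) < inverse (real (Suc n))" for n
    by (rule exists_scale_Lp_norm_less[OF p, of "inverse (real (Suc n))" "b n"]) auto
  then obtain \<epsilon> :: "nat \<Rightarrow> 'k" where \<epsilon>: "\<And>n. \<epsilon> n \<noteq> 0"
      "\<And>n. Lp_norm p (scale_L0 (\<epsilon> n) (b n)) < inverse (real (Suc n))"
    by metis
  \<comment> \<open>Outside the range of \<open>b\<close> the value \<open>inv b x\<close> is arbitrary, which is harmless: the tilt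
    allows any coefficients there.\<close>
  obtain W where W: "L0.subspace W" "L0.has_dim W \<alpha>" "W \<subseteq> A \<union> {0}"
      "\<And>x. x \<in> B \<Longrightarrow> x + scale_L0 (inverse (\<epsilon> (inv b x))) one_L0 \<in> W"
    using L0.has_dim_tilt[OF B A0 A_inv, where c = "\<lambda>x. inverse (\<epsilon> (inv b x))"] by metis
  obtain V where V: "L0.subspace V" "closedin (Lp_topology p) V" "W \<subseteq> V" "V \<subseteq> A \<union> {0}"
  proof -
    have "\<forall>W. L0.subspace W \<and> L0.has_dim W \<alpha> \<and> W \<subseteq> A \<union> {0} \<longrightarrow>
        (\<exists>V. L0.subspace V \<and> closedin (Lp_topology p) V \<and> L0.has_dim V \<beta> \<and> W \<subseteq> V \<and> V \<subseteq> A \<union> {0})"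
      using sp unfolding L0.spaceable_def by (elim conjE)
    then show thesis using W(1-3) that by meson
  qed
  interpret Metric_space "Lp p :: 'k L0 set" "Lp_dist p"
    by (rule Metric_space_Lp[OF p])
  have near: "scale_L0 (\<epsilon> n) (b n) + one_L0 \<in> V" for n
  proof -
    have "b n + scale_L0 (inverse (\<epsilon> n)) one_L0 \<in> V"
      using W(4)[of "b n"] b V(3) by auto
    from L0.subspace_scale[OF V(1) this, of "\<epsilon> n"] show ?thesis
      using \<epsilon>(1) by (simp add: L0.scale_right_distrib)
  qed
  have "one_L0 \<in> mtopology closure_of V"
    unfolding metric_closure_of
  proof (intro CollectI conjI allI impI)
    fix r :: real assume "r > 0"
    then obtain n where n: "inverse (real (Suc n)) < r" using reals_Archimedean by blast
    have "Lp_dist p one_L0 (scale_L0 (\<epsilon> n) (b n) + one_L0) = Lp_norm p (scale_L0 (\<epsilon> n) (b n))"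
      by (subst commute) (simp add: Lp_dist_def)
    moreover have "scale_L0 (\<epsilon> n) (b n) + one_L0 \<in> Lp p"
      using near[of n] closedin_subset[OF V(2)] by (auto simp: Lp_topology_def)
    ultimately show "\<exists>y\<in>V. y \<in> mball one_L0 r"
      using near[of n] \<epsilon>(2)[of n] n one_L0_in_Lp by (intro bexI[OF _ near[of n]]) auto
  qed (rule one_L0_in_Lp)
  then have "one_L0 \<in> V"
    using V(2) by (simp add: Lp_topology_def closure_of_closedin)
  then show False
    using V(4) A1 one_L0_nonzero by blast
qed

theorem corollary2p4:
  fixes \<alpha> :: "'a rel" and \<beta> :: "'b rel" and p :: real
  assumes "Card_order \<alpha>" and "Card_order \<beta>"
    and "natLeq \<le>o \<alpha>" and "\<alpha> \<le>o \<beta>"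
    and "p > 0"
  shows "\<not> L0.spaceable \<alpha> \<beta> (Lp_topology p) ((Lp p :: real L0 set) - (\<Union>q\<in>{p<..}. Lp q))
       \<and> \<not> L0.spaceable \<alpha> \<beta> (Lp_topology p) ((Lp p :: complex L0 set) - (\<Union>q\<in>{p<..}. Lp q))"
  using assms(3,5) by (intro conjI not_spaceable_Lp_minus_Union_Lq)

end
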